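(* Let $R$ be a commutative ring with identity $1\neq 0$ and let $I$ be a primary ideal of $R$. Then $R/I$ is a weak von Neumann regular ring.
   Context: All rings are commutative with identity $1\neq 0$. A ring $S$ is called a weak von Neumann regular ring (WVNR ring) if for all finitely generated ideals $I$ and $J$ of $S$ with $I \subseteq J \subsetneq S$: whenever $J$ is generated by an idempotent element of $S$, then $I$ is also generated by an idempotent element of $S$. Primary ideals are, as usual, proper ideals. *)

theory Defs
  imports "HOL-Algebra.QuotRing"
begin

locale primaryideal = ideal + cring +
  assumes I_notcarr: "carrier R \<noteq> I"
    and I_primary: "\<lbrakk>a \<in> carrier R; b \<in> carrier R; a \<otimes> b \<in> I\<rbrakk>
      \<Longrightarrow> a \<in> I \<or> (\<exists>n::nat. n > 0 \<and> b [^] n \<in> I)"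

locale finitely_generated_ideal = ideal +
  assumes finitely_generated: "\<exists>A \<subseteq> carrier R. finite A \<and> I = Idl A"

locale idempotent_generated_ideal = ideal +
  assumes idempotent_generated: "\<exists>e \<in> carrier R. e \<otimes> e = e \<and> I = Idl {e}"

locale weak_von_neumann_regular_ring = cring +
  assumes one_not_zero: "\<one> \<noteq> \<zero>"
    and weak_regular:
      "\<lbrakk>finitely_generated_ideal I R; finitely_generated_ideal J R; I \<subseteq> J; J \<subset> carrier R;
        idempotent_generated_ideal J R\<rbrakk> \<Longrightarrow> idempotent_generated_ideal I R"

end

theory Submission
  imports Defs
begin

text \<open>In \<open>R/I\<close> every zero divisor is nilpotent. For an idempotent \<open>e\<close> we have
  \<open>e (1 - e) = 0\<close>, so \<open>e = 0\<close> or the idempotent \<open>1 - e\<close> is nilpotent, hence \<open>0\<close>. Thus the only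
  proper ideal of \<open>R/I\<close> generated by an idempotent is the zero ideal.\<close>

lemma (in monoid) idempotent_nat_pow:
  assumes "e \<in> carrier G" "e \<otimes> e = e" "(n::nat) > 0"
  shows "e [^] n = e"
  using assms(3)
proof (induction n rule: nat_induct_non_zero)
  case 1
  then show ?case using assms(1) by simp
next
  case (Suc n)
  then show ?case using assms(2) by simp
qed

lemma (in cring) one_minus_idempotent:
  assumes "e \<in> carrier R" "e \<otimes> e = e"
  shows "e \<otimes> (\<one> \<ominus> e) = \<zero>" "(\<one> \<ominus> e) \<otimes> (\<one> \<ominus> e) = \<one> \<ominus> e"
proof -
  show *: "e \<otimes> (\<one> \<ominus> e) = \<zero>"
    using assms by (simp add: minus_eq r_distr r_minus r_neg)
  \<comment> \<open>Only the left factor is distributed, so the subtracted term is exactly the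
    product already shown to vanish.\<close>
  have "(\<one> \<ominus> e) \<otimes> (\<one> \<ominus> e) = (\<one> \<ominus> e) \<ominus> e \<otimes> (\<one> \<ominus> e)"
    using assms(1) by (simp add: minus_eq l_distr l_minus)
  then show "(\<one> \<ominus> e) \<otimes> (\<one> \<ominus> e) = \<one> \<ominus> e"
    using * assms(1) by (simp add: minus_eq)
qed

text \<open>Otherwise the coset of \<open>\<one>\<close> would be \<open>I\<close> itself, putting
  \<open>\<one>\<close> in \<open>I\<close> and contradicting properness.\<close>

lemma (in primaryideal) quotient_one_not_zero: "\<one>\<^bsub>R Quot I\<^esub> \<noteq> \<zero>\<^bsub>R Quot I\<^esub>"
proof
  assume "\<one>\<^bsub>R Quot I\<^esub> = \<zero>\<^bsub>R Quot I\<^esub>"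
  then have "I +> \<one> = I"
    by (simp add: FactRing_def)
  then have "\<one> \<in> I"
    using a_rcos_self[of \<one>] by simp
  then show False
    using one_imp_carrier I_notcarr by simp
qed

text \<open>This is the primary condition carried along the projection to the quotient: products and
  powers of cosets are cosets of products and powers, and a coset vanishes exactly when its
  representative lies in \<open>I\<close>.\<close>

lemma (in primaryideal) quotient_zero_divisor_nilpotent:
  assumes "x \<in> carrier (R Quot I)" "y \<in> carrier (R Quot I)"
    and "x \<otimes>\<^bsub>R Quot I\<^esub> y = \<zero>\<^bsub>R Quot I\<^esub>"
  shows "x = \<zero>\<^bsub>R Quot I\<^esub> \<or> (\<exists>n::nat. n > 0 \<and> y [^]\<^bsub>R Quot I\<^esub> n = \<zero>\<^bsub>R Quot I\<^esub>)"
proof -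
  have zero: "\<zero>\<^bsub>R Quot I\<^esub> = I"
    by (simp add: FactRing_def)
  obtain a b where ab: "a \<in> carrier R" "b \<in> carrier R" "x = I +> a" "y = I +> b"
    using assms(1,2) unfolding FactRing_def A_RCOSETS_def' by auto
  have zero_iff: "I +> c = \<zero>\<^bsub>R Quot I\<^esub> \<longleftrightarrow> c \<in> I" if "c \<in> carrier R" for c
    unfolding zero using a_rcos_self[OF that] a_rcos_const by blast
  interpret h: ring_hom_ring R "R Quot I" "(+>) I"
    by (rule rcos_ring_hom_ring)
  have "I +> (a \<otimes> b) = \<zero>\<^bsub>R Quot I\<^esub>"
    using assms(3) ab h.hom_mult by metis
  then have "a \<otimes> b \<in> I"
    using ab(1,2) zero_iff by blast
  then have "a \<in> I \<or> (\<exists>n::nat. n > 0 \<and> b [^] n \<in> I)"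
    using ab(1,2) I_primary by blast
  then show ?thesis
    unfolding ab(3,4) using ab(1,2) zero_iff nat_pow_closed h.hom_nat_pow by metis
qed

lemma (in primaryideal) quotient_idempotent_trivial:
  assumes "e \<in> carrier (R Quot I)" "e \<otimes>\<^bsub>R Quot I\<^esub> e = e"
  shows "e = \<zero>\<^bsub>R Quot I\<^esub> \<or> e = \<one>\<^bsub>R Quot I\<^esub>"
proof -
  interpret Q: cring "R Quot I"
    by (rule quotient_is_cring) (rule is_cring)
  let ?f = "\<one>\<^bsub>R Quot I\<^esub> \<ominus>\<^bsub>R Quot I\<^esub> e"
  have f: "?f \<in> carrier (R Quot I)"
    using assms(1) by simp
  consider "e = \<zero>\<^bsub>R Quot I\<^esub>"
    | n :: nat where "n > 0" "?f [^]\<^bsub>R Quot I\<^esub> n = \<zero>\<^bsub>R Quot I\<^esub>"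
    \<comment> \<open>The disjunction is asymmetric: \<open>e\<close> takes the place of the factor
      that may vanish, \<open>?f\<close> that of the nilpotent one.\<close>
    using quotient_zero_divisor_nilpotent[OF assms(1) f] Q.one_minus_idempotent(1)[OF assms]
    by blast
  then show ?thesis
  proof cases
    case 2
    \<comment> \<open>Since \<open>n > 0\<close>, the idempotent \<open>?f\<close> equals its own
      \<open>n\<close>-th power, which is zero.\<close>
    then have "?f = \<zero>\<^bsub>R Quot I\<^esub>"
      using Q.idempotent_nat_pow[OF f Q.one_minus_idempotent(2)[OF assms]] by simp
    then show ?thesis
      \<comment> \<open>The vanishing of \<open>?f\<close> makes one the additive inverse of the
        negative of \<open>e\<close>, and that inverse is \<open>e\<close>.\<close>
      using assms(1) by (metis Q.minus_eq Q.minus_equality Q.minus_minus Q.add.inv_closed Q.one_closed)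
  qed simp
qed

text \<open>Properness of \<open>J\<close> rules out the generator \<open>\<one>\<close>, so
  \<open>J\<close> is the zero ideal. Then \<open>I\<close> is squeezed to zero as well, and the
  idempotent \<open>\<zero>\<close> generates it.\<close>

lemma (in cring) trivial_idempotents_imp_weak_von_neumann_regular:
  assumes "\<one> \<noteq> \<zero>"
    and trivial: "\<And>e. \<lbrakk>e \<in> carrier R; e \<otimes> e = e\<rbrakk> \<Longrightarrow> e = \<zero> \<or> e = \<one>"
  shows "weak_von_neumann_regular_ring R"
proof (intro weak_von_neumann_regular_ring.intro weak_von_neumann_regular_ring_axioms.intro)
  show "cring R" by (rule is_cring)
next
  show "\<one> \<noteq> \<zero>" by fact
next
  fix I J
  assume "finitely_generated_ideal I R" and sub: "I \<subseteq> J" "J \<subset> carrier R"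
    and "idempotent_generated_ideal J R"
  then interpret I: ideal I R + J: idempotent_generated_ideal J R
    by (simp_all add: finitely_generated_ideal_def)
  obtain e where e: "e \<in> carrier R" "e \<otimes> e = e" "J = Idl {e}"
    using J.idempotent_generated by blast
  have "e \<noteq> \<one>"
    using e(3) sub(2) genideal_one by auto
  then have "J = {\<zero>}"
    using e trivial genideal_zero by auto
  then have "I = Idl {\<zero>}"
    using sub(1) I.zero_closed genideal_zero by auto
  then show "idempotent_generated_ideal I R"
    by (intro idempotent_generated_ideal.intro idempotent_generated_ideal_axioms.intro I.is_ideal)
      (auto intro!: bexI[of _ \<zero>])
qed

theorem theorem2p9:
  fixes R :: "('a, 'b) ring_scheme" (structure) and I :: "'a set"
  assumes "cring R" and "\<one> \<noteq> \<zero>"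
    and "primaryideal I R"
  shows "weak_von_neumann_regular_ring (R Quot I)"
proof -
  interpret primaryideal I R by fact
  interpret Q: cring "R Quot I"
    by (rule quotient_is_cring) fact
  show ?thesis
    by (rule Q.trivial_idempotents_imp_weak_von_neumann_regular
        [OF quotient_one_not_zero quotient_idempotent_trivial])
qed

end
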